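(* Assume that for each $i\in\mathcal I$ there is a constant $\rho_i$ such that $\|x^1-x^2\|_\ell\le\rho_i$ for any $x^1,x^2\in\mathcal X_i$. Let $(\bar v,\bar u,\{\bar\epsilon^k\}_{k\in\mathcal K})$ be a feasible solution to $\mathbf{MQIO}(\mathcal K,\tau,\theta)$, $\bar{\mathcal I}=\{i\in\mathcal I:\bar v_i=1\}\neq\emptyset$, $\bar{\mathcal S}=\{k\in\mathcal K:\bar u_k=1\}$, and $\bar c=\sum_{i\in\bar{\mathcal I}}\lambda_i a^i$ where $\lambda_i>0$ for all $i\in\bar{\mathcal I}$. Then $$\max_{x\in\mathcal X^*(\bar c)}\|\hat x^k-x\|_\ell\ \le\ \min_{x\in\bigcap_{i\in\bar{\mathcal I}}\mathcal X_i}\|\hat x^k-x\|_\ell+\min_{i\in\bar{\mathcal I}}\rho_i\qquad\text{for all }k\in\bar{\mathcal S}.$$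
   Context: Setting: $A\in\mathbb R^{m\times n}$, $b\in\mathbb R^m$, $\mathcal I=\{1,\dots,m\}$; $a^i\in\mathbb R^n$ is the $i$-th row of $A$ written as a column vector; prime denotes transpose. The forward feasible region $\mathcal X=\{x\in\mathbb R^n: Ax\ge b\}$ is bounded, full-dimensional and free of redundant constraints; $\mathcal X_i=\{x\in\mathcal X:{a^i}'x=b_i\}$. Norm parameters $\ell,p\ge1$ (possibly $\infty$) are fixed, and $\|a^i\|_p=1$ for all $i$. For $c\in\mathbb R^n$, $\mathcal X^*(c)=\arg\min_x\{c'x: x\in\mathcal X\}$. The dataset $\{\hat x^1,\dots,\hat x^K\}\subset\mathbb R^n$ is indexed by $\mathcal K=\{1,\dots,K\}$, with no assumption on feasibility or optimality of the points. $\tau\ge0$ and $\theta\in[0,1]$. $\mathbf{MQIO}(\mathcal K,\tau,\theta)$: maximize $\sum_{i\in\mathcal I}v_i$ over $v\in\{0,1\}^m$, $u\in\{0,1\}^K$, $\epsilon^k\in\mathbb R^n$ ($k\in\mathcal K$) subject to $b_i\le {a^i}'(\hat x^k-\epsilon^k)\le b_i+M_1(1-v_i)$ for all $i\in\mathcal I,k\in\mathcal K$; $\|\epsilon^k\|_\ell\le\tau+M_2(1-u_k)$ for all $k\in\mathcal K$; $\sum_{k=1}^K u_k\ge\theta K$. Here $M_1,M_2$ are sufficiently large constants, i.e. $M_1\ge\max_{i\in\mathcal I,x\in\mathcal X}({a^i}'x-b_i)$ and $M_2\ge\max_{k\in\mathcal K,x\in\mathcal X}\|\hat x^k-x\|_\ell$.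 *)

theory Defs
  imports "HOL-Analysis.Analysis"
begin

text \<open>The $p$-norm for $p \in [1,\infty]$; values of the exponent below 1 are not meaningful.\<close>

definition lp_norm :: "ereal \<Rightarrow> real ^ 'n \<Rightarrow> real" where
  "lp_norm p x =
     (if p = \<infinity> then infnorm x
      else (\<Sum>j\<in>UNIV. \<bar>x $ j\<bar> powr real_of_ereal p) powr (1 / real_of_ereal p))"

text \<open>The order on vectors is componentwise.\<close>

definition feasible_region :: "real ^ 'n ^ 'm \<Rightarrow> real ^ 'm \<Rightarrow> (real ^ 'n) set" where
  "feasible_region A b = {x. A *v x \<ge> b}"

definition facet :: "real ^ 'n ^ 'm \<Rightarrow> real ^ 'm \<Rightarrow> 'm \<Rightarrow> (real ^ 'n) set" where
  "facet A b i = {x \<in> feasible_region A b. row i A \<bullet> x = b $ i}"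

definition redundant_constraint :: "real ^ 'n ^ 'm \<Rightarrow> real ^ 'm \<Rightarrow> 'm \<Rightarrow> bool" where
  "redundant_constraint A b i \<longleftrightarrow>
     {x. \<forall>j. j \<noteq> i \<longrightarrow> row j A \<bullet> x \<ge> b $ j} = feasible_region A b"

definition optimal_set ::
    "real ^ 'n ^ 'm \<Rightarrow> real ^ 'm \<Rightarrow> real ^ 'n \<Rightarrow> (real ^ 'n) set" where
  "optimal_set A b c = {x. is_arg_min (\<lambda>y. c \<bullet> y) (\<lambda>y. y \<in> feasible_region A b) x}"

text \<open>The data points \<open>xhat k\<close>, the indicators \<open>u k\<close> and the perturbations \<open>\<epsilon> k\<close> only matter for
  \<open>k \<in> {1..K}\<close>.\<close>

definition MQIO_feasible ::
    "real ^ 'n ^ 'm \<Rightarrow> real ^ 'm \<Rightarrow> ereal \<Rightarrow> real \<Rightarrow> real \<Rightarrow> nat \<Rightarrow> (nat \<Rightarrow> real ^ 'n) \<Rightarrow>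
     real \<Rightarrow> real \<Rightarrow> real ^ 'm \<Rightarrow> (nat \<Rightarrow> real) \<Rightarrow> (nat \<Rightarrow> real ^ 'n) \<Rightarrow> bool" where
  "MQIO_feasible A b l M1 M2 K xhat \<tau> \<theta> v u \<epsilon> \<longleftrightarrow>
     (\<forall>i. v $ i \<in> {0, 1}) \<and>
     (\<forall>k\<in>{1..K}. u k \<in> {0, 1}) \<and>
     (\<forall>i. \<forall>k\<in>{1..K}. b $ i \<le> row i A \<bullet> (xhat k - \<epsilon> k) \<and>
        row i A \<bullet> (xhat k - \<epsilon> k) \<le> b $ i + M1 * (1 - v $ i)) \<and>
     (\<forall>k\<in>{1..K}. lp_norm l (\<epsilon> k) \<le> \<tau> + M2 * (1 - u k)) \<and>
     (\<Sum>k=1..K. u k) \<ge> \<theta> * real K"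

end

theory Submission
  imports Defs
begin

text \<open>
  A feasible solution of the program provides the point \<open>xhat k - \<epsilon> k\<close>, which lies in every facet
  indexed by \<open>Ibar\<close>. As \<open>cbar\<close> is a positive combination of the corresponding rows, the points
  optimal for \<open>cbar\<close> are therefore exactly the points of the intersection of these facets. This
  intersection is compact, so both extrema are attained. Each facet \<open>i \<in> Ibar\<close> contains both
  extremal points, which are thus at distance at most \<open>\<rho> i\<close>; the triangle inequality concludes.
\<close>

text \<open>Positive arguments are covered by \<open>powr_convex\<close>. If an argument vanishes,
  so does its term on both sides, and what remains is \<open>s powr p \<le> s\<close> for a weight
  \<open>s\<close> in [0, 1].\<close>

lemma powr_convex_combination_le:
  fixes x y t p :: real
  assumes "p \<ge> 1" "x \<ge> 0" "y \<ge> 0" "0 \<le> t" "t \<le> 1"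
  shows "((1 - t) * x + t * y) powr p \<le> (1 - t) * x powr p + t * y powr p"
proof -
  have scale: "(s * z) powr p \<le> s * z powr p" if "0 \<le> s" "s \<le> 1" "z \<ge> 0" for s z :: real
  proof -
    have "s powr p \<le> s"
      using powr_mono'[of 1 p s] that \<open>p \<ge> 1\<close> by simp
    then show ?thesis
      using that by (simp add: powr_mult mult_right_mono)
  qed
  consider "x = 0" | "y = 0" | "x > 0" "y > 0"
    using assms by fastforce
  then show ?thesis
  proof cases
    case 1
    then show ?thesis using scale[of t y] assms by simp
  next
    case 2
    then show ?thesis using scale[of "1 - t" x] assms by simp
  next
    case 3
    then show ?thesis
      using convex_onD[OF powr_convex[OF \<open>p \<ge> 1\<close>], of t x y] assms by simp
  qed
qed

lemma lp_norm_nonneg: "0 \<le> lp_norm p x"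
  by (simp add: lp_norm_def infnorm_pos_le)

lemma lp_norm_finite_powr:
  assumes "r \<ge> 1"
  shows "lp_norm (ereal r) x powr r = (\<Sum>j\<in>UNIV. \<bar>x $ j\<bar> powr r)"
  using assms by (simp add: lp_norm_def powr_powr sum_nonneg)

lemma lp_norm_finite_eq_0:
  assumes "r \<ge> 1" "lp_norm (ereal r) x = 0"
  shows "x = 0"
proof -
  have "(\<Sum>j\<in>UNIV. \<bar>x $ j\<bar> powr r) = 0"
    using lp_norm_finite_powr[OF assms(1), of x] assms by simp
  then show ?thesis
    by (simp add: sum_nonneg_eq_0_iff vec_eq_iff)
qed

text \<open>Minkowski's inequality by normalization: \<open>x + y\<close> is \<open>a + c\<close>
  times a convex combination of \<open>x / a\<close> and \<open>y / c\<close>, where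
  \<open>a\<close> and \<open>c\<close> are the norms. Convexity of the r-th power, applied to each
  coordinate, bounds that combination by norm 1.\<close>

lemma lp_norm_finite_triangle:
  fixes x y :: "real ^ 'n"
  assumes r: "r \<ge> 1"
  shows "lp_norm (ereal r) (x + y) \<le> lp_norm (ereal r) x + lp_norm (ereal r) y"
\<comment> \<open>The normalization divides by both norms, so a vanishing norm is treated apart:
  that vector is zero, and nonnegativity of the norm suffices.\<close>
proof (cases "lp_norm (ereal r) x = 0 \<or> lp_norm (ereal r) y = 0")
  case True
  then have "x = 0 \<or> y = 0"
    using lp_norm_finite_eq_0[OF r] by blast
  then show ?thesis
    using lp_norm_nonneg[of "ereal r" 0] by auto
next
  case False
  define a where "a = lp_norm (ereal r) x"
  define c where "c = lp_norm (ereal r) y"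
  \<comment> \<open>This weight gives \<open>(a + c) * (1 - t) = a\<close> and
    \<open>(a + c) * t = c\<close>, so the combination rescales to \<open>x + y\<close>.\<close>
  define t where "t = c / (a + c)"
  have pos: "a > 0" "c > 0"
    using False lp_norm_nonneg[of "ereal r" x] lp_norm_nonneg[of "ereal r" y]
    by (auto simp: a_def c_def)
  have t: "0 \<le> t" "t \<le> 1" and t': "1 - t = a / (a + c)"
    using pos by (auto simp: t_def field_simps)
  have term_le: "\<bar>(x + y) $ j\<bar> powr r
      \<le> (a + c) powr r * ((1 - t) * (\<bar>x $ j\<bar> powr r / a powr r) + t * (\<bar>y $ j\<bar> powr r / c powr r))"
    for j
  proof -
    have "\<bar>(x + y) $ j\<bar> \<le> (a + c) * ((1 - t) * (\<bar>x $ j\<bar> / a) + t * (\<bar>y $ j\<bar> / c))"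
    proof -
      have "(a + c) * ((1 - t) * (\<bar>x $ j\<bar> / a)) = \<bar>x $ j\<bar>" "(a + c) * (t * (\<bar>y $ j\<bar> / c)) = \<bar>y $ j\<bar>"
        using pos unfolding t' by (simp_all add: t_def)
      then show ?thesis
        by (simp only: distrib_left vector_add_component abs_triangle_ineq)
    qed
    then have "\<bar>(x + y) $ j\<bar> powr r
        \<le> ((a + c) * ((1 - t) * (\<bar>x $ j\<bar> / a) + t * (\<bar>y $ j\<bar> / c))) powr r"
      using r by (intro powr_mono2) auto
    also have "\<dots> = (a + c) powr r * ((1 - t) * (\<bar>x $ j\<bar> / a) + t * (\<bar>y $ j\<bar> / c)) powr r"
      using pos t by (simp add: powr_mult)
    also have "\<dots> \<le> (a + c) powr r * ((1 - t) * (\<bar>x $ j\<bar> / a) powr r + t * (\<bar>y $ j\<bar> / c) powr r)"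
      using pos t by (intro mult_left_mono powr_convex_combination_le r) auto
    finally show ?thesis
      using pos by (simp add: powr_divide)
  qed
  have "lp_norm (ereal r) (x + y) powr r
      \<le> (\<Sum>j\<in>UNIV. (a + c) powr r *
          ((1 - t) * (\<bar>x $ j\<bar> powr r / a powr r) + t * (\<bar>y $ j\<bar> powr r / c powr r)))"
    unfolding lp_norm_finite_powr[OF r] by (intro sum_mono term_le)
  \<comment> \<open>The coordinate powers of \<open>x\<close> and \<open>y\<close> add up to
    \<open>a powr r\<close> and \<open>c powr r\<close>, so the bracket becomes
    \<open>(1 - t) + t\<close>.\<close>
  also have "\<dots> = (a + c) powr r *
      ((1 - t) * (a powr r / a powr r) + t * (c powr r / c powr r))"
    unfolding a_def c_def lp_norm_finite_powr[OF r]
    by (simp add: sum.distrib flip: sum_distrib_left sum_divide_distrib)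
  also have "\<dots> = (a + c) powr r"
    using pos by simp
  \<comment> \<open>The r-th root is taken by contradiction: a norm above \<open>a + c\<close> would
    have a strictly larger r-th power.\<close>
  finally show ?thesis
    using r pos powr_less_mono2[of r "a + c" "lp_norm (ereal r) (x + y)"]
    by (force simp: a_def c_def)
qed

lemma lp_norm_triangle:
  assumes "p \<ge> 1"
  shows "lp_norm p (x + y) \<le> lp_norm p x + lp_norm p y"
proof (cases p)
  case (real r)
  then show ?thesis
    using lp_norm_finite_triangle assms by simp
next
  case PInf
  then show ?thesis
    by (simp add: lp_norm_def infnorm_triangle)
next
  case MInf
  then show ?thesis
    using assms by simp
qed

lemma continuous_on_lp_norm:
  assumes p: "p \<ge> 1" and f: "continuous_on S f"
  shows "continuous_on S (\<lambda>x. lp_norm p (f x))"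
proof (cases p)
  case (real r)
  then have "r \<ge> 1"
    using p by simp
  \<comment> \<open>Both exponents \<open>r\<close> and \<open>1 / r\<close> are positive, so
    \<open>powr\<close> is continuous at base 0 too, which covers zero coordinates and the zero
    vector.\<close>
  then show ?thesis
    unfolding lp_norm_def using real f
    by (auto intro!: continuous_intros continuous_on_powr' simp: sum_nonneg)
next
  case PInf
  then show ?thesis
    using f by (simp add: lp_norm_def continuous_on_infnorm)
next
  case MInf
  then show ?thesis
    using p by simp
qed

lemma mem_feasible_region: "x \<in> feasible_region A b \<longleftrightarrow> (\<forall>i. b $ i \<le> row i A \<bullet> x)"
  by (simp add: feasible_region_def less_eq_vec_def matrix_vector_mul_component row_def)

lemma closed_feasible_region: "closed (feasible_region A b)"
proof -
  have "feasible_region A b = (\<Inter>i. {x. row i A \<bullet> x \<ge> b $ i})"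
    by (auto simp: mem_feasible_region)
  then show ?thesis
    by (simp add: closed_INT closed_halfspace_ge)
qed

lemma closed_facet: "closed (facet A b i)"
proof -
  have "facet A b i = feasible_region A b \<inter> {x. row i A \<bullet> x = b $ i}"
    by (auto simp: facet_def)
  then show ?thesis
    by (simp add: closed_Int closed_feasible_region closed_hyperplane)
qed

text \<open>On the feasible region, \<open>c \<bullet> x\<close> exceeds the constant
  \<open>m\<close> by a positively weighted sum of the slacks of the constraints in
  \<open>I\<close>. It equals \<open>m\<close> exactly when all these slacks vanish, and
  \<open>z\<close> shows that \<open>m\<close> is attained.\<close>

lemma optimal_set_positive_combination:
  fixes A :: "real ^ 'n ^ 'm"
  assumes pos: "\<And>i. i \<in> I \<Longrightarrow> lam i > 0"
    and ne: "I \<noteq> {}" and z: "z \<in> (\<Inter>i\<in>I. facet A b i)"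
  shows "optimal_set A b (\<Sum>i\<in>I. lam i *\<^sub>R row i A) = (\<Inter>i\<in>I. facet A b i)"
proof -
  define c where "c = (\<Sum>i\<in>I. lam i *\<^sub>R row i A)"
  define m where "m = (\<Sum>i\<in>I. lam i * b $ i)"
  have fin: "finite I"
    by simp
  have c_inner: "c \<bullet> x = m + (\<Sum>i\<in>I. lam i * (row i A \<bullet> x - b $ i))" for x
    by (simp add: c_def m_def inner_sum_left right_diff_distrib sum_subtractf)
  have terms_nonneg: "0 \<le> lam i * (row i A \<bullet> x - b $ i)"
    if "x \<in> feasible_region A b" "i \<in> I" for x i
    using that pos by (simp add: mem_feasible_region less_imp_le)
  have lower: "m \<le> c \<bullet> x" if "x \<in> feasible_region A b" for x
    using terms_nonneg[OF that] by (simp add: c_inner sum_nonneg)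
  have attained: "c \<bullet> x = m \<longleftrightarrow> x \<in> (\<Inter>i\<in>I. facet A b i)" if "x \<in> feasible_region A b" for x
  proof -
    have "c \<bullet> x = m \<longleftrightarrow> (\<forall>i\<in>I. lam i * (row i A \<bullet> x - b $ i) = 0)"
      using sum_nonneg_eq_0_iff[OF fin terms_nonneg[OF that]] by (simp add: c_inner)
    also have "\<dots> \<longleftrightarrow> x \<in> (\<Inter>i\<in>I. facet A b i)"
      using that pos by (force simp: facet_def)
    finally show ?thesis .
  qed
  \<comment> \<open>For empty \<open>I\<close> the intersection would be the whole space.\<close>
  have facets_sub: "(\<Inter>i\<in>I. facet A b i) \<subseteq> feasible_region A b"
    using ne by (auto simp: facet_def)
  have "c \<bullet> z = m" "z \<in> feasible_region A b"
    using attained z facets_sub by blast+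
  then have "x \<in> optimal_set A b c \<longleftrightarrow> x \<in> feasible_region A b \<and> c \<bullet> x = m" for x
    unfolding optimal_set_def is_arg_min_def using lower by force
  then show ?thesis
    unfolding c_def[symmetric] using attained facets_sub by blast
qed

theorem proposition10:
  fixes A :: "real ^ 'n ^ 'm" and b :: "real ^ 'm"
    and l p :: ereal and M1 M2 \<tau> \<theta> :: real
    and K :: nat and xhat :: "nat \<Rightarrow> real ^ 'n"
    and \<rho> :: "'m \<Rightarrow> real"
    and v :: "real ^ 'm" and u :: "nat \<Rightarrow> real" and \<epsilon> :: "nat \<Rightarrow> real ^ 'n"
    and Ibar :: "'m set" and Sbar :: "nat set"
    and lam :: "'m \<Rightarrow> real" and cbar :: "real ^ 'n"
  assumes "bounded (feasible_region A b)"
    and "aff_dim (feasible_region A b) = int CARD('n)"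
    and "\<And>i. \<not> redundant_constraint A b i"
    and "l \<ge> 1" and "p \<ge> 1"
    and "\<And>i. lp_norm p (row i A) = 1"
    and "K \<ge> 1"
    and "\<tau> \<ge> 0" and "0 \<le> \<theta>" and "\<theta> \<le> 1"
    and "\<And>i x. x \<in> feasible_region A b \<Longrightarrow> row i A \<bullet> x - b $ i \<le> M1"
    and "\<And>k x. k \<in> {1..K} \<Longrightarrow> x \<in> feasible_region A b \<Longrightarrow> lp_norm l (xhat k - x) \<le> M2"
    and "\<And>i x1 x2. x1 \<in> facet A b i \<Longrightarrow> x2 \<in> facet A b i \<Longrightarrow> lp_norm l (x1 - x2) \<le> \<rho> i"
    and "MQIO_feasible A b l M1 M2 K xhat \<tau> \<theta> v u \<epsilon>"
    and "Ibar = {i. v $ i = 1}" and "Ibar \<noteq> {}"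
    and "Sbar = {k \<in> {1..K}. u k = 1}"
    and "\<And>i. i \<in> Ibar \<Longrightarrow> lam i > 0"
    and "cbar = (\<Sum>i\<in>Ibar. lam i *\<^sub>R row i A)"
  shows "\<forall>k\<in>Sbar. \<exists>xmax xmin.
    is_arg_max (\<lambda>x. lp_norm l (xhat k - x)) (\<lambda>x. x \<in> optimal_set A b cbar) xmax \<and>
    is_arg_min (\<lambda>x. lp_norm l (xhat k - x)) (\<lambda>x. x \<in> (\<Inter>i\<in>Ibar. facet A b i)) xmin \<and>
    lp_norm l (xhat k - xmax) \<le> lp_norm l (xhat k - xmin) + Min (\<rho> ` Ibar)"
proof
  fix k assume k: "k \<in> Sbar"
  define F where "F = (\<Inter>i\<in>Ibar. facet A b i)"
  define d where "d x = lp_norm l (xhat k - x)" for x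
  have kK: "k \<in> {1..K}"
    using k assms(17) by simp
  \<comment> \<open>Since \<open>v $ i = 1\<close>, the term \<open>M1 * (1 - v $ i)\<close>
    vanishes and the two bounds of the program squeeze to equality; the lower bounds for all rows
    give feasibility.\<close>
  have "xhat k - \<epsilon> k \<in> facet A b i" if "i \<in> Ibar" for i
  proof -
    have "v $ i = 1"
      using that assms(15) by simp
    then show ?thesis
      using assms(14) kK unfolding MQIO_feasible_def facet_def mem_feasible_region
      by (force intro: antisym)
  qed
  then have z: "xhat k - \<epsilon> k \<in> F"
    by (simp add: F_def)
  then have opt: "optimal_set A b cbar = F"
    unfolding assms(19) F_def by (intro optimal_set_positive_combination assms(16,18))
  have "F \<subseteq> feasible_region A b"
    using assms(16) by (auto simp: F_def facet_def)
  then have "bounded F"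
    using assms(1) bounded_subset by blast
  then have "compact F"
    by (simp add: compact_eq_bounded_closed F_def closed_INT closed_facet)
  moreover have "F \<noteq> {}"
    using z by blast
  moreover have "continuous_on F d"
    unfolding d_def by (intro continuous_on_lp_norm assms(4) continuous_intros)
  ultimately obtain xmax xmin where
    xmax: "xmax \<in> F" "\<And>y. y \<in> F \<Longrightarrow> d y \<le> d xmax" and
    xmin: "xmin \<in> F" "\<And>y. y \<in> F \<Longrightarrow> d xmin \<le> d y"
    by (metis continuous_attains_sup continuous_attains_inf)
  \<comment> \<open>An index attaining the minimum names a single facet whose diameter bound gives
    the sharpest estimate.\<close>
  have "Min (\<rho> ` Ibar) \<in> \<rho> ` Ibar"
    using assms(16) by (intro Min_in) auto
  then obtain i where i: "i \<in> Ibar" "Min (\<rho> ` Ibar) = \<rho> i"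
    by blast
  have "lp_norm l (xmin - xmax) \<le> \<rho> i"
    using xmax(1) xmin(1) i(1) by (intro assms(13)) (auto simp: F_def)
  \<comment> \<open>Here \<open>xhat k - xmax\<close> is split at \<open>xmin\<close>.\<close>
  then have "d xmax \<le> d xmin + Min (\<rho> ` Ibar)"
    using lp_norm_triangle[OF assms(4), of "xhat k - xmin" "xmin - xmax"] i(2)
    by (simp add: d_def)
  moreover have "is_arg_max d (\<lambda>x. x \<in> optimal_set A b cbar) xmax"
    using xmax by (auto simp: is_arg_max_def opt not_less)
  moreover have "is_arg_min d (\<lambda>x. x \<in> F) xmin"
    using xmin by (auto simp: is_arg_min_def not_less)
  ultimately show "\<exists>xmax xmin.
    is_arg_max (\<lambda>x. lp_norm l (xhat k - x)) (\<lambda>x. x \<in> optimal_set A b cbar) xmax \<and>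
    is_arg_min (\<lambda>x. lp_norm l (xhat k - x)) (\<lambda>x. x \<in> (\<Inter>i\<in>Ibar. facet A b i)) xmin \<and>
    lp_norm l (xhat k - xmax) \<le> lp_norm l (xhat k - xmin) + Min (\<rho> ` Ibar)"
    unfolding d_def F_def by blast
qed

end
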